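(* Let $\lambda_1,\lambda,\alpha,\beta>0$, let $N_1$ be a Poisson process with intensity $\lambda_1$, and let $G_N(t)=G(N(t))$, $t\ge 0$, be the compound Poisson-Gamma subordinator with parameters $\lambda,\alpha,\beta$, independent of $N_1$. For an integer $k\ge 1$ let $T_k=\inf\{s: N_1(G_N(s))=k\}$. Then for every $k\ge 1$ $$P\{T_k<\infty\}=\frac{\lambda_1^k}{k!\,(\lambda_1+\beta)^k}\left(1-\left(\frac{\beta}{\lambda_1+\beta}\right)^{\alpha}\right)\sum_{n=1}^{\infty}\left(\frac{\beta}{\lambda_1+\beta}\right)^{\alpha n}\frac{\Gamma(\alpha n+k)}{\Gamma(\alpha n)}.$$
   Context: The Gamma process $G$ with parameters $(\alpha,\beta)$ is the subordinator with $E e^{-uG(t)}=(1+u/\beta)^{-\alpha t}$. The compound Poisson-Gamma subordinator with parameters $\lambda,\alpha,\beta$ is $G_N(t)=G(N(t))$, where $N$ is a Poisson process with intensity $\lambda$ independent of $G$; its Laplace exponent is $f(u)=\lambda\beta^\alpha(\beta^{-\alpha}-(\beta+u)^{-\alpha})$ (so $E e^{-uG_N(t)}=e^{-tf(u)}$) and its Lévy measure is $\nu(du)=\lambda\beta^\alpha\Gamma(\alpha)^{-1}u^{\alpha-1}e^{-\beta u}du$ on $(0,\infty)$. The convention $\inf\emptyset=\infty$ is used. *)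

theory Defs
  imports "HOL-Probability.Probability"
begin

text \<open>
  Processes are indexed by \<open>real\<close>, and only their values at times \<open>t \<ge> 0\<close> matter. Following the usual
  definition of a Levy process, path properties are required almost surely. Left limits
  exist automatically for nondecreasing paths.
\<close>

locale subordinator = prob_space M
  for M :: "'a measure" and X :: "real \<Rightarrow> 'a \<Rightarrow> real" +
  assumes random_variable: "\<And>t. 0 \<le> t \<Longrightarrow> random_variable borel (X t)"
    and start_zero: "AE \<omega> in M. X 0 \<omega> = 0"
    and indep_increments: "\<And>(n::nat) (t::nat \<Rightarrow> real). 0 \<le> t 0 \<Longrightarrow> mono t \<Longrightarrow>
          indep_vars (\<lambda>_. borel) (\<lambda>i \<omega>. X (t (Suc i)) \<omega> - X (t i) \<omega>) {..<n}"
    and stationary_increments: "\<And>s t. 0 \<le> s \<Longrightarrow> 0 \<le> t \<Longrightarrow>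
          distr M borel (\<lambda>\<omega>. X (s + t) \<omega> - X s \<omega>) = distr M borel (X t)"
    and nondecreasing_paths: "AE \<omega> in M. mono_on {0..} (\<lambda>t. X t \<omega>)"
    and right_continuous_paths: "AE \<omega> in M. \<forall>t\<ge>0. continuous (at_right t) (\<lambda>s. X s \<omega>)"

text \<open>
  Almost surely, the jumps of the following process have size 1; this is a consequence of the
  axioms. The marginal law is prescribed for \<open>t > 0\<close> only, because \<open>poisson_pmf\<close> needs a
  positive parameter.
\<close>

locale poisson_process = subordinator M "\<lambda>t \<omega>. real (N t \<omega>)"
  for M :: "'a measure" and rate :: real and N :: "real \<Rightarrow> 'a \<Rightarrow> nat" +
  assumes rate_pos: "0 < rate"
    and poisson_marginals:
      "\<And>t. 0 < t \<Longrightarrow> distr M (count_space UNIV) (N t) = measure_pmf (poisson_pmf (rate * t))"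

locale gamma_process = subordinator M G
  for M :: "'a measure" and \<alpha> \<beta> :: real and G :: "real \<Rightarrow> 'a \<Rightarrow> real" +
  assumes parameters_pos: "0 < \<alpha>" "0 < \<beta>"
    and laplace_transform: "\<And>t u. 0 \<le> t \<Longrightarrow> 0 \<le> u \<Longrightarrow>
          expectation (\<lambda>\<omega>. exp (- u * G t \<omega>)) = (1 + u / \<beta>) powr (- \<alpha> * t)"

text \<open>
  Independence of two whole processes, i.e. of the sigma-algebras generated by all their values at
  times \<open>t \<ge> 0\<close>. As \<open>indep_var\<close> needs both variables to have the same type, \<open>nat\<close>-valued
  processes are to be embedded by \<open>real\<close>, which leaves the generated sigma-algebra unchanged.
\<close>

definition (in prob_space) indep_processes ::
    "(real \<Rightarrow> 'a \<Rightarrow> real) \<Rightarrow> (real \<Rightarrow> 'a \<Rightarrow> real) \<Rightarrow> bool" where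
  "indep_processes X Y \<longleftrightarrow>
     indep_var (\<Pi>\<^sub>M t\<in>{0..}. borel) (\<lambda>\<omega>. \<lambda>t\<in>{0..}. X t \<omega>)
               (\<Pi>\<^sub>M t\<in>{0..}. borel) (\<lambda>\<omega>. \<lambda>t\<in>{0..}. Y t \<omega>)"

definition subordinated :: "(real \<Rightarrow> 'a \<Rightarrow> 'b) \<Rightarrow> (real \<Rightarrow> 'a \<Rightarrow> real) \<Rightarrow> real \<Rightarrow> 'a \<Rightarrow> 'b" where
  "subordinated X S t \<omega> = X (S t \<omega>) \<omega>"

text \<open>Taking the infimum in \<open>ereal\<close> gives the value \<open>\<infinity>\<close> if the level \<open>k\<close> is never hit.\<close>

definition hitting_time :: "(real \<Rightarrow> 'a \<Rightarrow> nat) \<Rightarrow> nat \<Rightarrow> 'a \<Rightarrow> ereal" where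
  "hitting_time X k \<omega> = Inf {ereal s | s. 0 \<le> s \<and> X s \<omega> = k}"

end

theory Submission
  imports Defs
begin

text \<open>
  Almost surely \<open>N\<close> attains every natural number, so level \<open>k\<close> is hit if and only if the nondecreasing
  sequence \<open>W n = N1 (G n)\<close> visits \<open>k\<close>. Conditioning on \<open>G\<close> gives
  \<open>P(W n = k) = l1\<^sup>k / k! * E(G(n)\<^sup>k exp(- l1 G(n)))\<close>, which is obtained by differentiating the
  Laplace transform of \<open>G n\<close> \<open>k\<close> times at \<open>l1\<close>. By independence of the increments of \<open>G\<close>,
  \<open>P(W n = k, W (n + 1) = k) = r * P(W n = k)\<close> with \<open>r = (\<beta> / (l1 + \<beta>)) powr \<alpha>\<close>. Hence the last
  visit to \<open>k\<close> happens at \<open>n\<close> with probability \<open>(1 - r) * P(W n = k)\<close>, and summing over \<open>n\<close> gives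
  the formula.
\<close>

section \<open>Moments from the Laplace transform\<close>

text \<open>A single term of the exponential series is at most its sum:
  \<open>(u * x) ^ k / fact k \<le> exp (u * x)\<close>. The bound is uniform in \<open>x\<close>,
  so it serves both for integrability and as a dominating constant.\<close>

lemma power_mult_exp_le:
  fixes u x :: real
  assumes "0 < u" "0 \<le> x"
  shows "x ^ k * exp (- u * x) \<le> fact k / u ^ k"
proof -
  have "(\<Sum>n\<in>{k}. (u * x) ^ n / fact n) \<le> (\<Sum>n. (u * x) ^ n / fact n)"
    using summable_exp_generic[of "u * x"] assms
    by (intro sum_le_suminf) (auto simp: scaleR_conv_of_real divide_inverse mult_ac)
  then have "(u * x) ^ k / fact k \<le> exp (u * x)"
    by (simp add: exp_def scaleR_conv_of_real divide_inverse mult_ac)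
  then have "(u * x) ^ k * exp (- (u * x)) \<le> fact k"
    by (simp add: exp_minus field_simps)
  then show ?thesis
    using assms by (simp add: power_mult_distrib field_simps)
qed

text \<open>Mean value bound for \<open>v \<mapsto> exp (- v * x)\<close> on the half-line from
  \<open>u / 2\<close>. The restriction on \<open>h\<close> keeps \<open>u + h\<close> there, where
  the derivative is at most \<open>x * exp (- (u / 2) * x)\<close> in absolute value.\<close>

lemma abs_exp_diff_le:
  fixes u h x :: real
  assumes "0 \<le> x" "\<bar>h\<bar> \<le> u / 2"
  shows "\<bar>exp (- (u + h) * x) - exp (- u * x)\<bar> \<le> \<bar>h\<bar> * (x * exp (- (u / 2) * x))"
proof -
  have *: "norm (exp (- (u + h) * x) - exp (- u * x)) \<le> (x * exp (- (u / 2) * x)) * norm ((u + h) - u)"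
  proof (rule field_differentiable_bound[where S = "{u / 2..}" and f = "\<lambda>v. exp (- v * x)"
        and f' = "\<lambda>v. - x * exp (- v * x)"])
    fix v :: real assume "v \<in> {u / 2..}"
    then have "u / 2 * x \<le> v * x"
      using assms by (intro mult_right_mono) auto
    then show "norm (- x * exp (- v * x)) \<le> x * exp (- (u / 2) * x)"
      using assms by (simp add: abs_mult mult_left_mono)
  qed (use assms in \<open>auto intro!: derivative_eq_intros\<close>)
  then show ?thesis
    by (simp add: mult_ac)
qed

context prob_space
begin

lemma integrable_power_mult_exp:
  fixes X :: "'a \<Rightarrow> real"
  assumes [measurable]: "random_variable borel X" and "AE \<omega> in M. 0 \<le> X \<omega>" and "0 < u"
  shows "integrable M (\<lambda>\<omega>. X \<omega> ^ k * exp (- u * X \<omega>))"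
proof (rule integrable_const_bound)
  show "AE \<omega> in M. norm (X \<omega> ^ k * exp (- u * X \<omega>)) \<le> fact k / u ^ k"
    using assms(2) by eventually_elim (use assms(3) power_mult_exp_le[of u _ k] in \<open>simp add: abs_mult\<close>)
qed measurable

text \<open>Differentiation under the expectation: along every sequence tending to 0, the difference
  quotients are almost surely bounded by one constant, so dominated convergence applies.\<close>

lemma has_real_derivative_expectation_power_mult_exp:
  fixes X :: "'a \<Rightarrow> real"
  assumes [measurable]: "random_variable borel X" and X: "AE \<omega> in M. 0 \<le> X \<omega>" and u: "0 < u"
  shows "((\<lambda>v. expectation (\<lambda>\<omega>. X \<omega> ^ k * exp (- v * X \<omega>))) has_real_derivative
           - expectation (\<lambda>\<omega>. X \<omega> ^ Suc k * exp (- u * X \<omega>))) (at u)"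
proof -
  \<comment> \<open>Steps of size below \<open>u / 2\<close> keep \<open>u + h\<close> away from 0,
    which makes the bound on the quotients uniform in \<open>h\<close>.\<close>
  let ?S = "{- u / 2<..<u / 2}"
  let ?q = "\<lambda>h \<omega>. (X \<omega> ^ k * exp (- (u + h) * X \<omega>) - X \<omega> ^ k * exp (- u * X \<omega>)) / h"
  have lim: "((\<lambda>h. expectation (?q h)) \<longlongrightarrow> expectation (\<lambda>\<omega>. - (X \<omega> ^ Suc k * exp (- u * X \<omega>)))) (at 0 within ?S)"
    unfolding tendsto_at_iff_sequentially comp_def
  proof (intro allI impI)
    fix s assume s: "\<forall>i. s i \<in> ?S - {0}" and s0: "s \<longlonglongrightarrow> (0::real)"
    show "(\<lambda>i. expectation (?q (s i))) \<longlonglongrightarrow> expectation (\<lambda>\<omega>. - (X \<omega> ^ Suc k * exp (- u * X \<omega>)))"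
    \<comment> \<open>\<open>abs_exp_diff_le\<close> bounds the quotient by
      \<open>x ^ Suc k * exp (- (u / 2) * x)\<close>; the constant is
      \<open>power_mult_exp_le\<close> at \<open>Suc k\<close> and \<open>u / 2\<close>.\<close>
    proof (rule integral_dominated_convergence[where w = "\<lambda>_. fact (Suc k) / (u / 2) ^ Suc k"])
      show "AE \<omega> in M. (\<lambda>i. ?q (s i) \<omega>) \<longlonglongrightarrow> - (X \<omega> ^ Suc k * exp (- u * X \<omega>))"
      proof (rule AE_I2)
        fix \<omega>
        have "((\<lambda>v. X \<omega> ^ k * exp (- v * X \<omega>)) has_real_derivative - (X \<omega> ^ Suc k * exp (- u * X \<omega>))) (at u)"
          by (auto intro!: derivative_eq_intros)
        then have "((\<lambda>h. ?q h \<omega>) \<longlongrightarrow> - (X \<omega> ^ Suc k * exp (- u * X \<omega>))) (at 0)"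
          by (simp only: DERIV_def)
        then show "(\<lambda>i. ?q (s i) \<omega>) \<longlonglongrightarrow> - (X \<omega> ^ Suc k * exp (- u * X \<omega>))"
          using s s0 unfolding tendsto_at_iff_sequentially comp_def by blast
      qed
      show "AE \<omega> in M. norm (?q (s i) \<omega>) \<le> fact (Suc k) / (u / 2) ^ Suc k" for i
        using X
      proof eventually_elim
        fix \<omega> assume x: "0 \<le> X \<omega>"
        have i: "s i \<noteq> 0" "\<bar>s i\<bar> \<le> u / 2"
          using s[rule_format, of i] by auto
        have "norm (?q (s i) \<omega>) = X \<omega> ^ k * (\<bar>exp (- (u + s i) * X \<omega>) - exp (- u * X \<omega>)\<bar> / \<bar>s i\<bar>)"
          using x by (simp add: abs_mult flip: right_diff_distrib)
        also have "\<dots> \<le> X \<omega> ^ k * (X \<omega> * exp (- (u / 2) * X \<omega>))"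
          using abs_exp_diff_le[OF x i(2)] i x
          by (intro mult_left_mono) (auto simp: divide_simps mult_ac)
        also have "\<dots> = X \<omega> ^ Suc k * exp (- (u / 2) * X \<omega>)"
          by simp
        also have "\<dots> \<le> fact (Suc k) / (u / 2) ^ Suc k"
          using u x by (intro power_mult_exp_le) auto
        finally show "norm (?q (s i) \<omega>) \<le> fact (Suc k) / (u / 2) ^ Suc k" .
      qed
    qed simp_all
  qed
  have within: "at 0 within ?S = at 0"
    using u by (intro at_within_open) auto
  \<comment> \<open>Splitting the integral of the difference requires both terms to be integrable,
    hence \<open>0 < u + h\<close>; this is available only for \<open>h\<close> close to 0.\<close>
  have quot: "\<forall>\<^sub>F h in at 0. expectation (?q h) =
      (expectation (\<lambda>\<omega>. X \<omega> ^ k * exp (- (u + h) * X \<omega>)) - expectation (\<lambda>\<omega>. X \<omega> ^ k * exp (- u * X \<omega>))) / h"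
  proof -
    have "\<forall>\<^sub>F h in at 0. h \<in> ?S"
      using u by (intro eventually_at_in_open') auto
    then show ?thesis
    proof eventually_elim
      fix h assume "h \<in> ?S"
      then have "0 < u + h"
        using u by auto
      then show "expectation (?q h) =
        (expectation (\<lambda>\<omega>. X \<omega> ^ k * exp (- (u + h) * X \<omega>)) - expectation (\<lambda>\<omega>. X \<omega> ^ k * exp (- u * X \<omega>))) / h"
        using integrable_power_mult_exp[OF assms(1) X, of "u + h" k]
          integrable_power_mult_exp[OF assms(1) X, of u k] u
        by (subst integral_divide_zero, subst Bochner_Integration.integral_diff) simp_all
    qed
  qed
  have "((\<lambda>h. expectation (?q h)) \<longlongrightarrow> - expectation (\<lambda>\<omega>. X \<omega> ^ Suc k * exp (- u * X \<omega>))) (at 0)"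
    using lim by (simp only: within Bochner_Integration.integral_minus)
  then show ?thesis
    unfolding DERIV_def by (rule tendsto_cong[OF quot, THEN iffD1])
qed

text \<open>Induction on \<open>k\<close>: each differentiation of the closed form in
  \<open>u\<close> produces the factor \<open>a + k\<close> that extends the Pochhammer symbol.
  \<open>pochhammer a k\<close> plays the part of Gamma(a + k) / Gamma(a) and keeps its meaning at
  \<open>a = 0\<close>, the case of time 0.\<close>

lemma expectation_power_mult_exp_gamma:
  fixes X :: "'a \<Rightarrow> real"
  assumes "random_variable borel X" "AE \<omega> in M. 0 \<le> X \<omega>" "0 < \<beta>"
    and laplace: "\<And>u. 0 < u \<Longrightarrow> expectation (\<lambda>\<omega>. exp (- u * X \<omega>)) = (1 + u / \<beta>) powr (- a)"
    and "0 < u"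
  shows "expectation (\<lambda>\<omega>. X \<omega> ^ k * exp (- u * X \<omega>)) =
           (\<beta> / (\<beta> + u)) powr a * pochhammer a k / (\<beta> + u) ^ k"
  using \<open>0 < u\<close>
proof (induction k arbitrary: u)
  case 0
  then have "1 + u / \<beta> = (\<beta> + u) / \<beta>"
    using \<open>0 < \<beta>\<close> by (simp add: field_simps)
  with 0 show ?case
    using laplace[OF 0] \<open>0 < \<beta>\<close> by (simp add: powr_minus powr_divide field_simps)
next
  case (Suc k)
  let ?h = "\<lambda>u. \<beta> powr a * (\<beta> + u) powr (- a - real k) * pochhammer a k"
  have h: "(\<beta> / (\<beta> + u)) powr a * pochhammer a j / (\<beta> + u) ^ j =
      \<beta> powr a * (\<beta> + u) powr (- a - real j) * pochhammer a j" if "0 < u" for u j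
    using that \<open>0 < \<beta>\<close>
    by (simp add: powr_divide powr_diff powr_minus powr_realpow divide_simps)
  have "(?h has_real_derivative
      \<beta> powr a * ((- a - real k) * (\<beta> + u) powr (- a - real k - 1)) * pochhammer a k) (at u)"
    using Suc.prems \<open>0 < \<beta>\<close> by (auto intro!: derivative_eq_intros)
  moreover have "(?h has_real_derivative - expectation (\<lambda>\<omega>. X \<omega> ^ Suc k * exp (- u * X \<omega>))) (at u)"
  proof (rule has_field_derivative_transform_within_open)
    show "((\<lambda>v. expectation (\<lambda>\<omega>. X \<omega> ^ k * exp (- v * X \<omega>))) has_real_derivative
           - expectation (\<lambda>\<omega>. X \<omega> ^ Suc k * exp (- u * X \<omega>))) (at u)"
      using assms(1,2) Suc.prems by (rule has_real_derivative_expectation_power_mult_exp)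
    show "expectation (\<lambda>\<omega>. X \<omega> ^ k * exp (- v * X \<omega>)) = ?h v" if "v \<in> {0<..}" for v
      using that Suc.IH[of v] h[of v k] by simp
  qed (use Suc.prems in auto)
  ultimately have "expectation (\<lambda>\<omega>. X \<omega> ^ Suc k * exp (- u * X \<omega>)) =
      - (\<beta> powr a * ((- a - real k) * (\<beta> + u) powr (- a - real k - 1)) * pochhammer a k)"
    using DERIV_unique by fastforce
  also have "\<dots> = \<beta> powr a * (\<beta> + u) powr (- a - real (Suc k)) * pochhammer a (Suc k)"
    by (simp add: pochhammer_Suc algebra_simps)
  finally show ?case
    using h[OF Suc.prems, of "Suc k"] by simp
qed

text \<open>Conditioning on \<open>B\<close>: independence turns the joint law into a product
  measure, and Tonelli allows integrating over \<open>A\<close> with the value of \<open>B\<close>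
  frozen.\<close>

lemma nn_integral_indep_var:
  assumes "indep_var S A T B" and f: "case_prod f \<in> borel_measurable (S \<Otimes>\<^sub>M T)"
  shows "(\<integral>\<^sup>+ \<omega>. f (A \<omega>) (B \<omega>) \<partial>M) = (\<integral>\<^sup>+ \<omega>'. \<integral>\<^sup>+ \<omega>. f (A \<omega>) (B \<omega>') \<partial>M \<partial>M)"
proof -
  have [measurable]: "A \<in> measurable M S" "B \<in> measurable M T"
    using assms(1) by (auto dest: indep_var_rv1 indep_var_rv2)
  note f [measurable]
  interpret A: prob_space "distr M S A" by (rule prob_space_distr) simp
  interpret B: prob_space "distr M T B" by (rule prob_space_distr) simp
  interpret AB: pair_sigma_finite "distr M S A" "distr M T B" ..
  have "(\<integral>\<^sup>+ \<omega>. f (A \<omega>) (B \<omega>) \<partial>M) = (\<integral>\<^sup>+ p. case_prod f p \<partial>distr M (S \<Otimes>\<^sub>M T) (\<lambda>\<omega>. (A \<omega>, B \<omega>)))"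
    by (subst nn_integral_distr) simp_all
  also have "\<dots> = (\<integral>\<^sup>+ p. case_prod f p \<partial>(distr M S A \<Otimes>\<^sub>M distr M T B))"
    using assms(1) by (simp add: indep_var_distribution_eq)
  also have "\<dots> = (\<integral>\<^sup>+ b. \<integral>\<^sup>+ a. f a b \<partial>distr M S A \<partial>distr M T B)"
    by (subst AB.nn_integral_snd[symmetric]) simp_all
  also have "\<dots> = (\<integral>\<^sup>+ \<omega>'. \<integral>\<^sup>+ \<omega>. f (A \<omega>) (B \<omega>') \<partial>M \<partial>M)"
  proof -
    have "(\<integral>\<^sup>+ a. f a (B \<omega>') \<partial>distr M S A) = (\<integral>\<^sup>+ \<omega>. f (A \<omega>) (B \<omega>') \<partial>M)"
      if [measurable]: "\<omega>' \<in> space M" for \<omega>'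
      by (subst nn_integral_distr) simp_all
    then show ?thesis
      by (subst nn_integral_distr) (auto intro: nn_integral_cong)
  qed
  finally show ?thesis .
qed

end

section \<open>Values of a Poisson process\<close>

context subordinator
begin

lemma AE_nonneg:
  assumes "0 \<le> t"
  shows "AE \<omega> in M. 0 \<le> X t \<omega>"
  using nondecreasing_paths start_zero
proof eventually_elim
  fix \<omega> assume "mono_on {0..} (\<lambda>t. X t \<omega>)" "X 0 \<omega> = 0"
  then show "0 \<le> X t \<omega>"
    using assms mono_onD[of "{0..}" "\<lambda>t. X t \<omega>" 0 t] by simp
qed

text \<open>The first variable is the increment from time 0, since \<open>X 0\<close> vanishes only
  almost surely.\<close>

lemma indep_var_increment:
  assumes "0 \<le> s" "s \<le> t"
  shows "indep_var borel (\<lambda>\<omega>. X s \<omega> - X 0 \<omega>) borel (\<lambda>\<omega>. X t \<omega> - X s \<omega>)"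
proof -
  \<comment> \<open>The partition 0, \<open>s\<close>, \<open>t\<close> is continued constantly,
    because \<open>indep_increments\<close> asks for a monotone sequence on all natural
    numbers.\<close>
  let ?t = "\<lambda>i::nat. if i = 0 then 0 else if i = 1 then s else t"
  have "indep_vars (\<lambda>_. borel) (\<lambda>i \<omega>. X (?t (Suc i)) \<omega> - X (?t i) \<omega>) {..<2::nat}"
    using assms by (intro indep_increments) (auto simp: mono_def)
  also have "{..<2} = insert 0 {Suc 0}"
    by auto
  finally have "indep_var borel (\<lambda>\<omega>. X (?t (Suc 0)) \<omega> - X (?t 0) \<omega>)
      borel (\<lambda>\<omega>. \<Sum>i\<in>{Suc 0}. X (?t (Suc i)) \<omega> - X (?t i) \<omega>)"
    by (rule indep_vars_sum[rotated 2]) auto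
  then show ?thesis
    by simp
qed

end

text \<open>If the level is not reached by \<open>L\<close>, then
  \<open>f L < n \<le> f (Suc L) < f L + 2\<close>, which leaves only
  \<open>f (Suc L) = n\<close>.\<close>

lemma discrete_intermediate_value:
  fixes f :: "nat \<Rightarrow> nat"
  assumes "f 0 \<le> n" "n \<le> f L" "\<And>i. i < L \<Longrightarrow> f (Suc i) < f i + 2"
  shows "\<exists>i\<le>L. f i = n"
  using assms
proof (induction L)
  case (Suc L)
  show ?case
  proof (cases "n \<le> f L")
    case True
    then show ?thesis
      using Suc by (meson le_SucI less_SucI)
  next
    case False
    then have "f (Suc L) = n"
      using Suc.prems(2) Suc.prems(3)[of L] by simp
    then show ?thesis
      by blast
  qed
qed simp

section \<open>Finite-dimensional probabilities and surjectivity of Poisson paths\<close>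

context poisson_process
begin

lemma measurable_marginal [measurable]: "0 \<le> t \<Longrightarrow> N t \<in> measurable M (count_space UNIV)"
proof -
  assume "0 \<le> t"
  then have "(\<lambda>\<omega>. real (N t \<omega>)) \<in> borel_measurable M"
    by (rule random_variable)
  then have "(\<lambda>\<omega>. nat \<lfloor>real (N t \<omega>)\<rfloor>) \<in> measurable M (count_space UNIV)"
    by measurable
  then show ?thesis
    by simp
qed

lemma prob_eq:
  assumes "0 < t"
  shows "\<P>(\<omega> in M. N t \<omega> = k) = (rate * t) ^ k / fact k * exp (- (rate * t))"
proof -
  have "\<P>(\<omega> in M. N t \<omega> = k) = measure (distr M (count_space UNIV) (N t)) {k}"
    using assms by (subst measure_distr) (auto intro!: arg_cong[where f = prob])
  also have "\<dots> = pmf (poisson_pmf (rate * t)) k"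
    using assms by (simp add: poisson_marginals measure_pmf_single)
  finally show ?thesis
    using assms rate_pos by simp
qed

lemma prob_increment:
  assumes "0 \<le> s" "s \<le> t" and B: "B \<in> sets borel"
  shows "\<P>(\<omega> in M. real (N t \<omega>) - real (N s \<omega>) \<in> B) = \<P>(\<omega> in M. real (N (t - s) \<omega>) \<in> B)"
proof -
  have "measure (distr M borel (\<lambda>\<omega>. real (N (s + (t - s)) \<omega>) - real (N s \<omega>))) B =
    measure (distr M borel (\<lambda>\<omega>. real (N (t - s) \<omega>))) B"
    using assms by (subst stationary_increments) auto
  then show ?thesis
    using assms by (simp add: measure_distr vimage_def Int_def conj_commute)
qed

text \<open>The event means an increment \<open>k\<close> up to time \<open>s\<close> and an
  increment 0 from \<open>s\<close> to \<open>t\<close>. These are independent, and their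
  exponential factors combine to \<open>exp (- (rate * t))\<close>.\<close>

lemma prob_joint_eq:
  assumes "0 < s" "s \<le> t"
  shows "\<P>(\<omega> in M. N s \<omega> = k \<and> N t \<omega> = k) = (rate * s) ^ k / fact k * exp (- (rate * t))"
\<comment> \<open>The Poisson law is prescribed at positive times only, so the second increment
  needs \<open>0 < t - s\<close>.\<close>
proof (cases "s = t")
  case True
  then show ?thesis
    using prob_eq[OF assms(1)] by simp
next
  case False
  have [measurable]: "N s \<in> measurable M (count_space UNIV)" "N t \<in> measurable M (count_space UNIV)"
    "N 0 \<in> measurable M (count_space UNIV)"
    using assms by auto
  have "\<P>(\<omega> in M. N s \<omega> = k \<and> N t \<omega> = k) =
      \<P>(\<omega> in M. real (N s \<omega>) - real (N 0 \<omega>) \<in> {real k} \<and> real (N t \<omega>) - real (N s \<omega>) \<in> {0})"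
    using start_zero by (intro measure_eq_AE, eventually_elim) (simp, safe, measurable)
  also have "\<dots> = \<P>(\<omega> in M. real (N s \<omega>) - real (N 0 \<omega>) \<in> {real k}) * \<P>(\<omega> in M. real (N t \<omega>) - real (N s \<omega>) \<in> {0})"
    using assms by (intro prob_indep_random_variable[where N = borel] indep_var_increment) auto
  also have "\<P>(\<omega> in M. real (N s \<omega>) - real (N 0 \<omega>) \<in> {real k}) = \<P>(\<omega> in M. N s \<omega> = k)"
    using start_zero by (intro measure_eq_AE) auto
  also have "\<P>(\<omega> in M. real (N t \<omega>) - real (N s \<omega>) \<in> {0}) = \<P>(\<omega> in M. N (t - s) \<omega> = 0)"
    using assms by (subst prob_increment) auto
  finally show ?thesis
    using assms False by (simp add: prob_eq algebra_simps flip: exp_add)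
qed

text \<open>With \<open>x = rate * t\<close>, the probability is
  \<open>1 - (1 + x) * exp (- x)\<close>, and \<open>exp (- x) \<ge> 1 - x\<close> bounds it by the
  square of \<open>x\<close>. This quadratic order outweighs the number of grid intervals in
  \<open>AE_small_steps\<close>.\<close>

lemma prob_ge_2:
  assumes "0 < t"
  shows "\<P>(\<omega> in M. 2 \<le> N t \<omega>) \<le> (rate * t)\<^sup>2"
proof -
  have [measurable]: "N t \<in> measurable M (count_space UNIV)"
    using assms by auto
  have "\<P>(\<omega> in M. 2 \<le> N t \<omega>) = 1 - \<P>(\<omega> in M. N t \<omega> = 0 \<or> N t \<omega> = 1)"
    by (subst prob_neg[symmetric]) (auto intro!: arg_cong[where f = prob])
  also have "\<P>(\<omega> in M. N t \<omega> = 0 \<or> N t \<omega> = 1) = \<P>(\<omega> in M. N t \<omega> = 0) + \<P>(\<omega> in M. N t \<omega> = 1)"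
    by (subst finite_measure_Union[symmetric]) (auto intro!: arg_cong[where f = prob])
  also have "\<dots> = (1 + rate * t) * exp (- (rate * t))"
    using assms prob_eq[of t 0] prob_eq[of t 1] by (simp add: algebra_simps)
  finally have "\<P>(\<omega> in M. 2 \<le> N t \<omega>) = 1 - (1 + rate * t) * exp (- (rate * t))" .
  moreover have "(1 + rate * t) * (1 - rate * t) \<le> (1 + rate * t) * exp (- (rate * t))"
    using assms rate_pos exp_ge_add_one_self[of "- (rate * t)"] by (intro mult_left_mono) auto
  ultimately show ?thesis
    by (simp add: algebra_simps power2_eq_square)
qed

text \<open>Staying below \<open>n\<close> forever is at most as likely as being below
  \<open>n\<close> at time \<open>T\<close>. That probability is a finite sum of Poisson weights,
  each tending to 0 as \<open>T\<close> grows.\<close>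

lemma AE_unbounded: "AE \<omega> in M. \<exists>T::nat. n \<le> N (real T) \<omega>"
proof -
  have [measurable]: "N (real i) \<in> measurable M (count_space UNIV)" for i :: nat
    by auto
  have "(\<lambda>T. \<Sum>k<n. (rate * real T) ^ k / fact k * exp (- (rate * real T))) \<longlonglongrightarrow> (\<Sum>k<n. 0)"
  proof (rule tendsto_sum)
    fix k
    have "((\<lambda>x. x ^ k / exp x) \<longlongrightarrow> 0) (at_top::real filter)"
      by (rule tendsto_power_div_exp_0)
    moreover have "filterlim (\<lambda>T. rate * real T) at_top sequentially"
      using rate_pos by (intro filterlim_tendsto_pos_mult_at_top[OF tendsto_const] filterlim_real_sequentially)
    ultimately have "(\<lambda>T. (rate * real T) ^ k / exp (rate * real T)) \<longlonglongrightarrow> 0"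
      by (rule filterlim_compose)
    then have "(\<lambda>T. (rate * real T) ^ k / exp (rate * real T) / fact k) \<longlonglongrightarrow> 0"
      by (rule tendsto_divide_zero)
    then show "(\<lambda>T. (rate * real T) ^ k / fact k * exp (- (rate * real T))) \<longlonglongrightarrow> 0"
      by (simp add: exp_minus field_simps)
  qed
  moreover have "\<forall>\<^sub>F T in sequentially. \<P>(\<omega> in M. \<forall>T::nat. N (real T) \<omega> < n) \<le>
      (\<Sum>k<n. (rate * real T) ^ k / fact k * exp (- (rate * real T)))"
    using eventually_gt_at_top[of 0]
  proof eventually_elim
    fix T :: nat assume T: "0 < T"
    have "\<P>(\<omega> in M. \<forall>T::nat. N (real T) \<omega> < n) \<le> prob (\<Union>k<n. {\<omega> \<in> space M. N (real T) \<omega> = k})"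
      by (intro finite_measure_mono) auto
    also have "\<dots> \<le> (\<Sum>k<n. \<P>(\<omega> in M. N (real T) \<omega> = k))"
      by (intro finite_measure_subadditive_finite) auto
    finally show "\<P>(\<omega> in M. \<forall>T::nat. N (real T) \<omega> < n) \<le>
        (\<Sum>k<n. (rate * real T) ^ k / fact k * exp (- (rate * real T)))"
      using T by (simp add: prob_eq)
  qed
  ultimately have "\<P>(\<omega> in M. \<forall>T::nat. N (real T) \<omega> < n) \<le> (\<Sum>k<n. 0)"
    by (intro tendsto_lowerbound[of _ _ sequentially]) auto
  then have "\<P>(\<omega> in M. \<forall>T::nat. N (real T) \<omega> < n) = 0"
    by (simp add: measure_le_0_iff)
  then show ?thesis
    by (subst (asm) prob_eq_0) (auto simp: not_less)
qed

text \<open>There are \<open>m * T\<close> intervals of length \<open>1 / m\<close>, each with an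
  increment of at least 2 with probability at most \<open>(rate / m)^2\<close>. The union bound is
  of order \<open>1 / m\<close>, so the event that every mesh fails is null.\<close>

lemma AE_small_steps:
  "AE \<omega> in M. \<exists>m::nat. 0 < m \<and> (\<forall>i<m * T. N (real (Suc i) / real m) \<omega> < N (real i / real m) \<omega> + 2)"
proof -
  have [measurable]: "N (real i / real m) \<in> measurable M (count_space UNIV)" for i m :: nat
    by auto
  let ?bad = "\<lambda>m i \<omega>. 2 \<le> real (N (real (Suc i) / real m) \<omega>) - real (N (real i / real m) \<omega>)"
  have "(\<lambda>m. rate\<^sup>2 * real T * (1 / real m)) \<longlonglongrightarrow> rate\<^sup>2 * real T * 0"
    by (intro tendsto_intros lim_1_over_n)
  moreover have "\<forall>\<^sub>F m in sequentially. \<P>(\<omega> in M. \<forall>m. 0 < m \<longrightarrow> (\<exists>i<m * T. ?bad m i \<omega>)) \<le> rate\<^sup>2 * real T * (1 / real m)"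
    using eventually_gt_at_top[of 0]
  proof eventually_elim
    fix m :: nat assume m: "0 < m"
    have "\<P>(\<omega> in M. \<forall>m. 0 < m \<longrightarrow> (\<exists>i<m * T. ?bad m i \<omega>)) \<le> prob (\<Union>i<m * T. {\<omega> \<in> space M. ?bad m i \<omega>})"
      using m by (intro finite_measure_mono) auto
    also have "\<dots> \<le> (\<Sum>i<m * T. \<P>(\<omega> in M. ?bad m i \<omega>))"
      by (intro finite_measure_subadditive_finite) auto
    also have "\<dots> \<le> (\<Sum>i<m * T. (rate * (1 / real m))\<^sup>2)"
    proof (rule sum_mono)
      fix i
      have "\<P>(\<omega> in M. ?bad m i \<omega>) = \<P>(\<omega> in M. real (N (real (Suc i) / real m) \<omega>) - real (N (real i / real m) \<omega>) \<in> {2..})"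
        by simp
      also have "\<dots> = \<P>(\<omega> in M. real (N (real (Suc i) / real m - real i / real m) \<omega>) \<in> {2..})"
        by (rule prob_increment) (auto simp: divide_right_mono)
      also have "real (Suc i) / real m - real i / real m = 1 / real m"
        by (simp add: diff_divide_distrib[symmetric])
      finally show "\<P>(\<omega> in M. ?bad m i \<omega>) \<le> (rate * (1 / real m))\<^sup>2"
        using prob_ge_2[of "1 / real m"] m by simp
    qed
    also have "\<dots> = rate\<^sup>2 * real T * (1 / real m)"
      using m by (simp add: power2_eq_square field_simps)
    finally show "\<P>(\<omega> in M. \<forall>m. 0 < m \<longrightarrow> (\<exists>i<m * T. ?bad m i \<omega>)) \<le> rate\<^sup>2 * real T * (1 / real m)" .
  qed
  ultimately have "\<P>(\<omega> in M. \<forall>m. 0 < m \<longrightarrow> (\<exists>i<m * T. ?bad m i \<omega>)) \<le> rate\<^sup>2 * real T * 0"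
    by (intro tendsto_lowerbound[of _ _ sequentially]) auto
  then have "\<P>(\<omega> in M. \<forall>m. 0 < m \<longrightarrow> (\<exists>i<m * T. ?bad m i \<omega>)) = 0"
    by (simp add: measure_le_0_iff)
  then have "AE \<omega> in M. \<not> (\<forall>m. 0 < m \<longrightarrow> (\<exists>i<m * T. ?bad m i \<omega>))"
    by (subst (asm) prob_eq_0) auto
  then show ?thesis
  proof eventually_elim
    fix \<omega> assume "\<not> (\<forall>m. 0 < m \<longrightarrow> (\<exists>i<m * T. ?bad m i \<omega>))"
    then obtain m where m: "0 < m" "\<And>i. i < m * T \<Longrightarrow> \<not> ?bad m i \<omega>"
      by blast
    have "N (real (Suc i) / real m) \<omega> < N (real i / real m) \<omega> + 2" if "i < m * T" for i
      using m(2)[OF that] by linarith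
    then show "\<exists>m::nat. 0 < m \<and> (\<forall>i<m * T. N (real (Suc i) / real m) \<omega> < N (real i / real m) \<omega> + 2)"
      using m(1) by blast
  qed
qed

text \<open>A path that exceeds \<open>n\<close> by time \<open>T\<close> and moves by at most 1
  between neighbouring points of some grid must meet \<open>n\<close> on that grid. The grid points
  are rational, as \<open>next_value\<close> looks only at rational times.\<close>

lemma AE_attains_all_values: "AE \<omega> in M. \<forall>n. \<exists>q\<in>\<rat> \<inter> {0..}. N q \<omega> = n"
proof -
  have "AE \<omega> in M. \<forall>T. \<exists>m::nat. 0 < m \<and> (\<forall>i<m * T. N (real (Suc i) / real m) \<omega> < N (real i / real m) \<omega> + 2)"
    using AE_small_steps by (simp add: AE_all_countable)
  moreover have "AE \<omega> in M. \<forall>n. \<exists>T::nat. n \<le> N (real T) \<omega>"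
    using AE_unbounded by (simp add: AE_all_countable)
  ultimately show ?thesis
    using start_zero
  proof eventually_elim
    fix \<omega>
    assume small: "\<forall>T. \<exists>m::nat. 0 < m \<and> (\<forall>i<m * T. N (real (Suc i) / real m) \<omega> < N (real i / real m) \<omega> + 2)"
      and unb: "\<forall>n. \<exists>T::nat. n \<le> N (real T) \<omega>" and 0: "real (N 0 \<omega>) = 0"
    show "\<forall>n. \<exists>q\<in>\<rat> \<inter> {0..}. N q \<omega> = n"
    proof
      fix n
      obtain T :: nat where T: "n \<le> N (real T) \<omega>"
        using unb by blast
      obtain m :: nat where m: "0 < m" "\<And>i. i < m * T \<Longrightarrow> N (real (Suc i) / real m) \<omega> < N (real i / real m) \<omega> + 2"
        using small by blast
      have "\<exists>i\<le>m * T. N (real i / real m) \<omega> = n"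
        using 0 T m by (intro discrete_intermediate_value) auto
      moreover have "real i / real m \<in> \<rat> \<inter> {0..}" for i
        by simp
      ultimately show "\<exists>q\<in>\<rat> \<inter> {0..}. N q \<omega> = n"
        by blast
    qed
  qed
qed

end

section \<open>Poisson processes at independent random times\<close>

text \<open>
  As the values \<open>G 0 < G 1 < G 2 < \<dots>\<close> are exactly the values of a path of \<open>G\<^sub>N\<close> at rational
  times, \<open>nth_value\<close> recovers the sequence \<open>G n\<close> from that path in a measurable way. This is needed
  because \<open>N1\<close> is assumed independent of \<open>G\<^sub>N\<close> only, not of \<open>G\<close>.
\<close>

definition next_value :: "(real \<Rightarrow> real) \<Rightarrow> real \<Rightarrow> real" where
  "next_value g c = real_of_ereal (INF q\<in>\<rat> \<inter> {0..}. if c < g q then ereal (g q) else \<infinity>)"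

primrec nth_value :: "(real \<Rightarrow> real) \<Rightarrow> nat \<Rightarrow> real" where
  "nth_value g 0 = 0"
| "nth_value g (Suc n) = next_value g (nth_value g n)"

lemma countable_nonneg_Rats: "countable (\<rat> \<inter> {0..} :: real set)"
  using countable_rat by (rule countable_subset[rotated]) auto

text \<open>The infimum in \<open>next_value\<close> runs over a countable set of times, so it
  preserves measurability with respect to the product sigma-algebra.\<close>

lemma nth_value_measurable [measurable]:
  "(\<lambda>g. nth_value g n) \<in> borel_measurable (\<Pi>\<^sub>M t\<in>{0..}. borel)"
proof (induction n)
  case (Suc n)
  note Suc [measurable]
  have "(\<lambda>g. INF q\<in>\<rat> \<inter> {0..}. if nth_value g n < g q then ereal (g q) else \<infinity>)
      \<in> borel_measurable (\<Pi>\<^sub>M t\<in>{0..}. borel)"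
    by (intro borel_measurable_INF countable_nonneg_Rats) measurable
  then show ?case
    by (simp add: next_value_def)
qed simp

text \<open>Among the values of \<open>g\<close> at nonnegative rationals, which are exactly the
  \<open>c m\<close>, the infimum of those above \<open>c n\<close> is attained at
  \<open>c (Suc n)\<close>; in particular it is finite and \<open>real_of_ereal\<close> does not
  fall back to its default.\<close>

lemma nth_value_eq:
  fixes c :: "nat \<Rightarrow> real"
  assumes "strict_mono c" "c 0 = 0" "g ` (\<rat> \<inter> {0..}) = range c"
  shows "nth_value g n = c n"
proof (induction n)
  case (Suc n)
  have "(INF q\<in>\<rat> \<inter> {0..}. if c n < g q then ereal (g q) else \<infinity>) = ereal (c (Suc n))"
  proof (rule antisym)
    have "c (Suc n) \<in> g ` (\<rat> \<inter> {0..})"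
      unfolding assms(3) by (rule rangeI)
    then obtain q where "q \<in> \<rat> \<inter> {0..}" "g q = c (Suc n)"
      by (rule imageE) simp
    then show "(INF q\<in>\<rat> \<inter> {0..}. if c n < g q then ereal (g q) else \<infinity>) \<le> ereal (c (Suc n))"
      using strict_monoD[OF assms(1), of n "Suc n"] by (intro INF_lower2[of q]) auto
  next
    have "c (Suc n) \<le> g q" if "q \<in> \<rat> \<inter> {0..}" "c n < g q" for q
    proof -
      have "g q \<in> range c"
        unfolding assms(3)[symmetric] using that(1) by (rule imageI)
      then obtain m where "g q = c m"
        by (rule rangeE)
      with that(2) show ?thesis
        using assms(1) by (simp add: strict_mono_less strict_mono_less_eq)
    qed
    then show "ereal (c (Suc n)) \<le> (INF q\<in>\<rat> \<inter> {0..}. if c n < g q then ereal (g q) else \<infinity>)"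
      by (intro INF_greatest) auto
  qed
  with Suc show ?case
    by (simp add: next_value_def)
qed (simp add: assms)

text \<open>For \<open>x \<ge> 0\<close> this is the least multiple of \<open>1 / Suc m\<close>
  strictly above \<open>x\<close>. Strictness makes the approximation come from the right, and the
  truncation by \<open>nat\<close> keeps the value positive for every real \<open>x\<close>.\<close>

definition grid_ceiling :: "nat \<Rightarrow> real \<Rightarrow> real" where
  "grid_ceiling m x = (real (nat \<lfloor>real (Suc m) * x\<rfloor>) + 1) / real (Suc m)"

lemma grid_ceiling_pos: "0 < grid_ceiling m x"
  unfolding grid_ceiling_def by (intro divide_pos_pos) auto

lemma grid_ceiling_mono: "x \<le> y \<Longrightarrow> grid_ceiling m x \<le> grid_ceiling m y"
  unfolding grid_ceiling_def
  by (intro divide_right_mono add_right_mono of_nat_mono nat_mono floor_mono mult_left_mono) auto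

lemma measurable_grid_ceiling [measurable]: "grid_ceiling m \<in> borel_measurable borel"
  unfolding grid_ceiling_def by measurable

lemma grid_ceiling_bounds:
  assumes "0 \<le> x"
  shows "x < grid_ceiling m x" "grid_ceiling m x \<le> x + 1 / real (Suc m)"
proof -
  have "0 \<le> \<lfloor>real (Suc m) * x\<rfloor>"
    using assms by simp
  then have e: "real (nat \<lfloor>real (Suc m) * x\<rfloor>) = of_int \<lfloor>real (Suc m) * x\<rfloor>"
    by simp
  have "real (Suc m) * x < of_int \<lfloor>real (Suc m) * x\<rfloor> + 1"
    by linarith
  then show "x < grid_ceiling m x"
    unfolding grid_ceiling_def e by (simp add: field_simps del: of_nat_Suc)
  have "of_int \<lfloor>real (Suc m) * x\<rfloor> \<le> real (Suc m) * x"
    by linarith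
  then show "grid_ceiling m x \<le> x + 1 / real (Suc m)"
    unfolding grid_ceiling_def e by (simp add: field_simps del: of_nat_Suc)
qed

lemma filterlim_grid_ceiling:
  assumes "0 \<le> x"
  shows "filterlim (\<lambda>m. grid_ceiling m x) (at_right x) sequentially"
  unfolding filterlim_at
proof (rule conjI)
  show "\<forall>\<^sub>F m in sequentially. grid_ceiling m x \<in> {x<..} \<and> grid_ceiling m x \<noteq> x"
    by (rule always_eventually) (simp add: grid_ceiling_bounds(1)[OF assms] less_imp_neq[symmetric])
  show "(\<lambda>m. grid_ceiling m x) \<longlonglongrightarrow> x"
  proof (rule tendsto_sandwich[of "\<lambda>_. x"])
    show "(\<lambda>m. x + 1 / real (Suc m)) \<longlonglongrightarrow> x"
      using tendsto_add[OF tendsto_const LIMSEQ_Suc[OF lim_1_over_n], of x] by simp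
    show "\<forall>\<^sub>F m in sequentially. x \<le> grid_ceiling m x"
      by (rule always_eventually) (simp add: grid_ceiling_bounds(1)[OF assms] less_imp_le)
    show "\<forall>\<^sub>F m in sequentially. grid_ceiling m x \<le> x + 1 / real (Suc m)"
      by (rule always_eventually) (use grid_ceiling_bounds(2)[OF assms] in blast)
  qed simp
qed

text \<open>The rounded time takes countably many values, so the composition is glued from countably
  many measurable functions; for an unrounded random time this argument would fail.\<close>

lemma measurable_grid_ceiling_compose:
  assumes [measurable]: "X \<in> borel_measurable M'" and f: "\<And>t. 0 < t \<Longrightarrow> f t \<in> measurable M' M''"
  shows "(\<lambda>\<omega>. f (grid_ceiling m (X \<omega>)) \<omega>) \<in> measurable M' M''"
proof -
  have "(\<lambda>\<omega>. f ((real i + 1) / real (Suc m)) \<omega>) \<in> measurable M' M''" for i :: nat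
    by (intro f divide_pos_pos) auto
  then show ?thesis
    unfolding grid_ceiling_def
    by (rule measurable_compose_countable[where g = "\<lambda>\<omega>. nat \<lfloor>real (Suc m) * X \<omega>\<rfloor>"]) measurable
qed

section \<open>Rounded random times and their limit\<close>

context poisson_process
begin

text \<open>Both times are functionals of the path of \<open>S\<close>, which is independent of
  \<open>N\<close>. Freezing that path reduces the claim to \<open>prob_joint_eq\<close> at two
  deterministic times.\<close>

lemma prob_grid_eq:
  fixes S :: "real \<Rightarrow> 'a \<Rightarrow> real" and F H :: "(real \<Rightarrow> real) \<Rightarrow> real"
  assumes indep: "indep_processes (\<lambda>t \<omega>. real (N t \<omega>)) S"
    and [measurable]: "F \<in> borel_measurable (\<Pi>\<^sub>M t\<in>{0..}. borel)" "H \<in> borel_measurable (\<Pi>\<^sub>M t\<in>{0..}. borel)"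
    and X: "X = (\<lambda>\<omega>. F (\<lambda>t\<in>{0..}. S t \<omega>))" and Y: "Y = (\<lambda>\<omega>. H (\<lambda>t\<in>{0..}. S t \<omega>))"
    and le: "AE \<omega> in M. X \<omega> \<le> Y \<omega>"
  shows "\<P>(\<omega> in M. N (grid_ceiling m (X \<omega>)) \<omega> = k \<and> N (grid_ceiling m (Y \<omega>)) \<omega> = k) =
    expectation (\<lambda>\<omega>. (rate * grid_ceiling m (X \<omega>)) ^ k / fact k * exp (- (rate * grid_ceiling m (Y \<omega>))))"
proof -
  let ?P = "\<Pi>\<^sub>M t\<in>{0..}. (borel :: real measure)"
  let ?A = "\<lambda>\<omega>. \<lambda>t\<in>{0..}. real (N t \<omega>)" and ?B = "\<lambda>\<omega>. \<lambda>t\<in>{0..}. S t \<omega>"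
  let ?f = "\<lambda>g g'. indicator {real k} (g (grid_ceiling m (F g'))) * indicator {real k} (g (grid_ceiling m (H g'))) :: ennreal"
  let ?\<phi> = "\<lambda>\<omega>. (rate * grid_ceiling m (X \<omega>)) ^ k / fact k * exp (- (rate * grid_ceiling m (Y \<omega>)))"
  have ind: "indep_var ?P ?A ?P ?B"
    using indep unfolding indep_processes_def .
  have B [measurable]: "?B \<in> measurable M ?P"
    using ind by (rule indep_var_rv2)
  have XY [measurable]: "X \<in> borel_measurable M" "Y \<in> borel_measurable M"
    unfolding X Y by measurable
  have [measurable]: "(\<lambda>\<omega>. N (grid_ceiling m (Z \<omega>)) \<omega>) \<in> measurable M (count_space UNIV)"
    if "Z \<in> borel_measurable M" for Z
    using that by (rule measurable_grid_ceiling_compose) auto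
  \<comment> \<open>Evaluating a path at a rounded time that depends on the other path is jointly
    measurable, again because only countably many times occur.\<close>
  have fm: "case_prod ?f \<in> borel_measurable (?P \<Otimes>\<^sub>M ?P)"
  proof -
    have "(\<lambda>p. (fst p) (grid_ceiling m (F (snd p)))) \<in> borel_measurable (?P \<Otimes>\<^sub>M ?P)"
      "(\<lambda>p. (fst p) (grid_ceiling m (H (snd p)))) \<in> borel_measurable (?P \<Otimes>\<^sub>M ?P)"
      by (rule measurable_grid_ceiling_compose[where f = "\<lambda>t p. fst p t"]; measurable; simp)+
    then show ?thesis
      unfolding split_beta' by measurable
  qed
  \<comment> \<open>The paths in \<open>?A\<close> are restricted to nonnegative times; they agree
    with \<open>N\<close> at the rounded times only because these are nonnegative.\<close>
  have pos: "0 \<le> grid_ceiling m x" for x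
    using grid_ceiling_pos[of m x] by simp
  have "emeasure M {\<omega> \<in> space M. N (grid_ceiling m (X \<omega>)) \<omega> = k \<and> N (grid_ceiling m (Y \<omega>)) \<omega> = k} =
      (\<integral>\<^sup>+ \<omega>. indicator {\<omega> \<in> space M. N (grid_ceiling m (X \<omega>)) \<omega> = k \<and> N (grid_ceiling m (Y \<omega>)) \<omega> = k} \<omega> \<partial>M)"
    by (subst nn_integral_indicator) auto
  also have "\<dots> = (\<integral>\<^sup>+ \<omega>. ?f (?A \<omega>) (?B \<omega>) \<partial>M)"
    using pos by (intro nn_integral_cong) (auto simp: X Y split: split_indicator)
  also have "\<dots> = (\<integral>\<^sup>+ \<omega>'. \<integral>\<^sup>+ \<omega>. ?f (?A \<omega>) (?B \<omega>') \<partial>M \<partial>M)"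
    by (rule nn_integral_indep_var[OF ind fm])
  also have "\<dots> = (\<integral>\<^sup>+ \<omega>'. ennreal (?\<phi> \<omega>') \<partial>M)"
  proof (rule nn_integral_cong_AE)
    show "AE \<omega>' in M. (\<integral>\<^sup>+ \<omega>. ?f (?A \<omega>) (?B \<omega>') \<partial>M) = ennreal (?\<phi> \<omega>')"
      using le
    proof eventually_elim
      fix \<omega>' assume le: "X \<omega>' \<le> Y \<omega>'"
      let ?x = "grid_ceiling m (X \<omega>')" and ?y = "grid_ceiling m (Y \<omega>')"
      have [measurable]: "N ?x \<in> measurable M (count_space UNIV)" "N ?y \<in> measurable M (count_space UNIV)"
        using pos by auto
      have "(\<integral>\<^sup>+ \<omega>. ?f (?A \<omega>) (?B \<omega>') \<partial>M) = (\<integral>\<^sup>+ \<omega>. indicator {\<omega> \<in> space M. N ?x \<omega> = k \<and> N ?y \<omega> = k} \<omega> \<partial>M)"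
        using pos by (intro nn_integral_cong) (auto simp: X Y split: split_indicator)
      also have "\<dots> = ennreal (\<P>(\<omega> in M. N ?x \<omega> = k \<and> N ?y \<omega> = k))"
        by (subst nn_integral_indicator) (auto simp: emeasure_eq_measure)
      also have "\<dots> = ennreal (?\<phi> \<omega>')"
        by (subst prob_joint_eq) (auto simp: grid_ceiling_pos grid_ceiling_mono le)
      finally show "(\<integral>\<^sup>+ \<omega>. ?f (?A \<omega>) (?B \<omega>') \<partial>M) = ennreal (?\<phi> \<omega>')" .
    qed
  qed
  finally have "emeasure M {\<omega> \<in> space M. N (grid_ceiling m (X \<omega>)) \<omega> = k \<and> N (grid_ceiling m (Y \<omega>)) \<omega> = k} =
    (\<integral>\<^sup>+ \<omega>'. ennreal (?\<phi> \<omega>') \<partial>M)" .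
  then show ?thesis
    using pos rate_pos by (subst integral_eq_nn_integral) (auto simp: measure_def)
qed

text \<open>
  A measurable version of \<open>\<omega> \<mapsto> N (X \<omega>) \<omega>\<close>, which itself need not be measurable since
  right continuity holds only almost surely.
\<close>

definition at_random_time :: "('a \<Rightarrow> real) \<Rightarrow> 'a \<Rightarrow> real" where
  "at_random_time X \<omega> = lim (\<lambda>m. real (N (grid_ceiling m (X \<omega>)) \<omega>))"

lemma measurable_at_random_time [measurable]:
  assumes [measurable]: "X \<in> borel_measurable M"
  shows "at_random_time X \<in> borel_measurable M"
proof -
  have "(\<lambda>\<omega>. real (N (grid_ceiling m (X \<omega>)) \<omega>)) \<in> borel_measurable M" for m
    by (rule measurable_grid_ceiling_compose) (auto intro: random_variable)
  then show ?thesis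
    unfolding at_random_time_def by measurable
qed

lemma AE_grid_tendsto:
  assumes "AE \<omega> in M. 0 \<le> X \<omega>"
  shows "AE \<omega> in M. (\<lambda>m. real (N (grid_ceiling m (X \<omega>)) \<omega>)) \<longlonglongrightarrow> real (N (X \<omega>) \<omega>)"
  using assms right_continuous_paths
proof eventually_elim
  fix \<omega> assume "0 \<le> X \<omega>" "\<forall>t\<ge>0. continuous (at_right t) (\<lambda>s. real (N s \<omega>))"
  then show "(\<lambda>m. real (N (grid_ceiling m (X \<omega>)) \<omega>)) \<longlonglongrightarrow> real (N (X \<omega>) \<omega>)"
    by (auto simp: continuous_within intro: filterlim_compose filterlim_grid_ceiling)
qed

lemma AE_at_random_time:
  assumes "AE \<omega> in M. 0 \<le> X \<omega>"
  shows "AE \<omega> in M. at_random_time X \<omega> = real (N (X \<omega>) \<omega>)"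
  using AE_grid_tendsto[OF assms]
  by eventually_elim (auto simp: at_random_time_def intro: limI)

text \<open>Let the grid in \<open>prob_grid_eq\<close> be refined: both of its sides converge by
  dominated convergence, the left one through right continuity of the paths, and limits are
  unique.\<close>

lemma prob_at_random_times_eq:
  fixes S :: "real \<Rightarrow> 'a \<Rightarrow> real" and F H :: "(real \<Rightarrow> real) \<Rightarrow> real"
  assumes indep: "indep_processes (\<lambda>t \<omega>. real (N t \<omega>)) S"
    and F: "F \<in> borel_measurable (\<Pi>\<^sub>M t\<in>{0..}. borel)" and H: "H \<in> borel_measurable (\<Pi>\<^sub>M t\<in>{0..}. borel)"
    and X: "X = (\<lambda>\<omega>. F (\<lambda>t\<in>{0..}. S t \<omega>))" and Y: "Y = (\<lambda>\<omega>. H (\<lambda>t\<in>{0..}. S t \<omega>))"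
    and nonneg: "AE \<omega> in M. 0 \<le> X \<omega>" and le: "AE \<omega> in M. X \<omega> \<le> Y \<omega>"
  shows "\<P>(\<omega> in M. at_random_time X \<omega> = real k \<and> at_random_time Y \<omega> = real k) =
    expectation (\<lambda>\<omega>. (rate * X \<omega>) ^ k / fact k * exp (- (rate * Y \<omega>)))"
proof (rule LIMSEQ_unique)
  let ?P = "\<Pi>\<^sub>M t\<in>{0..}. (borel :: real measure)"
  have [measurable]: "(\<lambda>\<omega>. \<lambda>t\<in>{0..}. S t \<omega>) \<in> measurable M ?P"
    using indep unfolding indep_processes_def by (rule indep_var_rv2)
  note F [measurable] H [measurable]
  have [measurable]: "X \<in> borel_measurable M" "Y \<in> borel_measurable M"
    unfolding X Y by measurable
  have [measurable]: "(\<lambda>\<omega>. N (grid_ceiling m (Z \<omega>)) \<omega>) \<in> measurable M (count_space UNIV)"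
    if "Z \<in> borel_measurable M" for Z m
    using that by (rule measurable_grid_ceiling_compose) auto
  have nonneg': "AE \<omega> in M. 0 \<le> Y \<omega>"
    using nonneg le by eventually_elim simp
  let ?D = "\<lambda>m. {\<omega> \<in> space M. N (grid_ceiling m (X \<omega>)) \<omega> = k \<and> N (grid_ceiling m (Y \<omega>)) \<omega> = k}"
  let ?E = "{\<omega> \<in> space M. at_random_time X \<omega> = real k \<and> at_random_time Y \<omega> = real k}"
  have "(\<lambda>m. expectation (indicator (?D m))) \<longlonglongrightarrow> expectation (indicator ?E :: 'a \<Rightarrow> real)"
  proof (rule integral_dominated_convergence[where w = "\<lambda>_. 1"])
    show "AE \<omega> in M. (\<lambda>m. indicator (?D m) \<omega>) \<longlonglongrightarrow> (indicator ?E \<omega> :: real)"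
      using AE_grid_tendsto[OF nonneg] AE_grid_tendsto[OF nonneg']
        AE_at_random_time[OF nonneg] AE_at_random_time[OF nonneg']
    proof eventually_elim
      fix \<omega> assume "(\<lambda>m. real (N (grid_ceiling m (X \<omega>)) \<omega>)) \<longlonglongrightarrow> real (N (X \<omega>) \<omega>)"
        "(\<lambda>m. real (N (grid_ceiling m (Y \<omega>)) \<omega>)) \<longlonglongrightarrow> real (N (Y \<omega>) \<omega>)"
      \<comment> \<open>A convergent sequence of natural numbers is eventually constant, so the
        indicators eventually coincide with their limit.\<close>
      then have "\<forall>\<^sub>F m in sequentially. N (grid_ceiling m (X \<omega>)) \<omega> = N (X \<omega>) \<omega>"
        and "\<forall>\<^sub>F m in sequentially. N (grid_ceiling m (Y \<omega>)) \<omega> = N (Y \<omega>) \<omega>"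
        by (simp_all add: tendsto_discrete tendsto_of_nat_iff)
      then have ev: "\<forall>\<^sub>F m in sequentially. N (grid_ceiling m (X \<omega>)) \<omega> = N (X \<omega>) \<omega> \<and>
          N (grid_ceiling m (Y \<omega>)) \<omega> = N (Y \<omega>) \<omega>"
        by (rule eventually_conj)
      assume W: "at_random_time X \<omega> = real (N (X \<omega>) \<omega>)" "at_random_time Y \<omega> = real (N (Y \<omega>) \<omega>)"
      have "\<forall>\<^sub>F m in sequentially. indicator (?D m) \<omega> = (indicator ?E \<omega> :: real)"
        using ev by eventually_elim (auto simp: W split: split_indicator)
      then show "(\<lambda>m. indicator (?D m) \<omega>) \<longlonglongrightarrow> (indicator ?E \<omega> :: real)"
        by (rule tendsto_eventually)
    qed
  qed (auto split: split_indicator)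
  then show "(\<lambda>m. prob (?D m)) \<longlonglongrightarrow> prob ?E"
    by simp
  have "(\<lambda>m. expectation (\<lambda>\<omega>. (rate * grid_ceiling m (X \<omega>)) ^ k / fact k * exp (- (rate * grid_ceiling m (Y \<omega>))))) \<longlonglongrightarrow>
    expectation (\<lambda>\<omega>. (rate * X \<omega>) ^ k / fact k * exp (- (rate * Y \<omega>)))"
  proof (rule integral_dominated_convergence[where w = "\<lambda>_. 1"])
    show "AE \<omega> in M. (\<lambda>m. (rate * grid_ceiling m (X \<omega>)) ^ k / fact k * exp (- (rate * grid_ceiling m (Y \<omega>)))) \<longlonglongrightarrow>
        (rate * X \<omega>) ^ k / fact k * exp (- (rate * Y \<omega>))"
      using nonneg nonneg'
    proof eventually_elim
      fix \<omega> assume "0 \<le> X \<omega>" "0 \<le> Y \<omega>"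
      then have "(\<lambda>m. grid_ceiling m (X \<omega>)) \<longlonglongrightarrow> X \<omega>" "(\<lambda>m. grid_ceiling m (Y \<omega>)) \<longlonglongrightarrow> Y \<omega>"
        using filterlim_grid_ceiling unfolding filterlim_at by blast+
      then show "(\<lambda>m. (rate * grid_ceiling m (X \<omega>)) ^ k / fact k * exp (- (rate * grid_ceiling m (Y \<omega>)))) \<longlonglongrightarrow>
          (rate * X \<omega>) ^ k / fact k * exp (- (rate * Y \<omega>))"
        by (intro tendsto_intros) auto
    qed
    show "AE \<omega> in M. norm ((rate * grid_ceiling m (X \<omega>)) ^ k / fact k * exp (- (rate * grid_ceiling m (Y \<omega>)))) \<le> 1" for m
      using le
    proof eventually_elim
      fix \<omega> assume "X \<omega> \<le> Y \<omega>"
      \<comment> \<open>With \<open>x\<close> and \<open>y\<close> the rounded times multiplied by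
        \<open>rate\<close>, \<open>x \<le> y\<close> gives
        \<open>x ^ k * exp (- y) \<le> x ^ k * exp (- x)\<close>, which is at most
        \<open>fact k\<close> by \<open>power_mult_exp_le\<close> with parameter 1. Hence the
        dominating constant 1.\<close>
      then have "(rate * grid_ceiling m (X \<omega>)) ^ k * exp (- (rate * grid_ceiling m (Y \<omega>))) \<le>
          (rate * grid_ceiling m (X \<omega>)) ^ k * exp (- 1 * (rate * grid_ceiling m (X \<omega>)))"
        using rate_pos grid_ceiling_pos[of m "X \<omega>"]
        by (intro mult_left_mono) (auto intro: grid_ceiling_mono)
      also have "\<dots> \<le> fact k / 1 ^ k"
        using rate_pos grid_ceiling_pos[of m "X \<omega>"] by (intro power_mult_exp_le) auto
      finally show "norm ((rate * grid_ceiling m (X \<omega>)) ^ k / fact k * exp (- (rate * grid_ceiling m (Y \<omega>)))) \<le> 1"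
        using rate_pos grid_ceiling_pos[of m "X \<omega>"] by (simp add: abs_mult)
    qed
  qed (auto intro!: borel_measurable_times borel_measurable_divide borel_measurable_power borel_measurable_exp)
  then show "(\<lambda>m. prob (?D m)) \<longlonglongrightarrow> expectation (\<lambda>\<omega>. (rate * X \<omega>) ^ k / fact k * exp (- (rate * Y \<omega>)))"
    unfolding prob_grid_eq[OF indep F H X Y le] .
qed

end

section \<open>The hitting probability\<close>

context prob_space
begin

text \<open>The events that the last visit happens at \<open>n\<close> are disjoint, and by
  monotonicity each means leaving \<open>x\<close> in the next step, which has probability
  \<open>(1 - r) * \<P>(W n = x)\<close>. It remains to see that a visited level almost surely has a
  last visit.\<close>

lemma sums_prob_last_visit:
  fixes W :: "nat \<Rightarrow> 'a \<Rightarrow> real"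
  assumes rv [measurable]: "\<And>n. random_variable borel (W n)"
    and mono: "AE \<omega> in M. incseq (\<lambda>n. W n \<omega>)"
    and stay: "\<And>n. \<P>(\<omega> in M. W n \<omega> = x \<and> W (Suc n) \<omega> = x) = r * \<P>(\<omega> in M. W n \<omega> = x)"
    and "r < 1"
  shows "(\<lambda>n. (1 - r) * \<P>(\<omega> in M. W n \<omega> = x)) sums \<P>(\<omega> in M. \<exists>n. W n \<omega> = x)"
proof -
  let ?C = "\<lambda>n. {\<omega> \<in> space M. W n \<omega> = x \<and> (\<forall>m>n. W m \<omega> \<noteq> x)}"
  have "disjoint_family ?C"
    unfolding disjoint_family_on_def by (auto, metis linorder_neqE_nat)
  then have "(\<lambda>n. prob (?C n)) sums prob (\<Union>n. ?C n)"
    by (intro finite_measure_UNION) auto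
  moreover have C: "prob (?C n) = (1 - r) * \<P>(\<omega> in M. W n \<omega> = x)" for n
  proof -
    have "prob (?C n) = prob ({\<omega> \<in> space M. W n \<omega> = x} - {\<omega> \<in> space M. W n \<omega> = x \<and> W (Suc n) \<omega> = x})"
    proof (rule measure_eq_AE)
      show "AE \<omega> in M. \<omega> \<in> ?C n \<longleftrightarrow> \<omega> \<in> {\<omega> \<in> space M. W n \<omega> = x} - {\<omega> \<in> space M. W n \<omega> = x \<and> W (Suc n) \<omega> = x}"
        using mono
      proof eventually_elim
        fix \<omega> assume "incseq (\<lambda>n. W n \<omega>)"
        then have "W n \<omega> \<le> W (Suc n) \<omega>" "W (Suc n) \<omega> \<le> W m \<omega>" if "n < m" for m
          using that by (auto intro: incseqD[of "\<lambda>n. W n \<omega>"])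
        then show "\<omega> \<in> ?C n \<longleftrightarrow> \<omega> \<in> {\<omega> \<in> space M. W n \<omega> = x} - {\<omega> \<in> space M. W n \<omega> = x \<and> W (Suc n) \<omega> = x}"
          by fastforce
      qed
    qed measurable
    also have "\<dots> = (1 - r) * \<P>(\<omega> in M. W n \<omega> = x)"
      by (subst finite_measure_Diff) (auto simp: stay algebra_simps)
    finally show ?thesis .
  qed
  ultimately have sums: "(\<lambda>n. (1 - r) * \<P>(\<omega> in M. W n \<omega> = x)) sums prob (\<Union>n. ?C n)"
    by simp
  \<comment> \<open>Convergence of the series just obtained forces its terms to 0; since
    \<open>1 - r\<close> is nonzero, remaining at \<open>x\<close> forever then has probability
    0.\<close>
  then have "(\<lambda>n. (1 - r) * \<P>(\<omega> in M. W n \<omega> = x)) \<longlonglongrightarrow> 0"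
    by (rule summable_LIMSEQ_zero[OF sums_summable])
  then have lim: "(\<lambda>n. \<P>(\<omega> in M. W n \<omega> = x)) \<longlonglongrightarrow> 0"
    using tendsto_divide[of _ 0 _ "\<lambda>_. 1 - r" "1 - r"] \<open>r < 1\<close> by simp
  have "AE \<omega> in M. \<not> (\<forall>m\<ge>n. W m \<omega> = x)" for n
  proof -
    have "\<P>(\<omega> in M. \<forall>m\<ge>n. W m \<omega> = x) \<le> 0"
    proof (rule tendsto_lowerbound[OF lim])
      show "\<forall>\<^sub>F m in sequentially. \<P>(\<omega> in M. \<forall>m\<ge>n. W m \<omega> = x) \<le> \<P>(\<omega> in M. W m \<omega> = x)"
        using eventually_ge_at_top[of n] by eventually_elim (auto intro!: finite_measure_mono)
    qed simp
    then have "\<P>(\<omega> in M. \<forall>m\<ge>n. W m \<omega> = x) = 0"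
      by (simp add: measure_le_0_iff)
    then show ?thesis
      by (subst (asm) prob_eq_0) auto
  qed
  then have "AE \<omega> in M. \<forall>n. \<exists>m\<ge>n. W m \<omega> \<noteq> x"
    by (auto simp: AE_all_countable)
  then have "prob (\<Union>n. ?C n) = \<P>(\<omega> in M. \<exists>n. W n \<omega> = x)"
    using mono
  proof (intro measure_eq_AE, eventually_elim)
    fix \<omega> assume leave: "\<forall>n. \<exists>m\<ge>n. W m \<omega> \<noteq> x" and mono: "incseq (\<lambda>n. W n \<omega>)"
    have "\<exists>n. W n \<omega> = x \<and> (\<forall>m>n. W m \<omega> \<noteq> x)" if n: "W n \<omega> = x" for n
    proof -
      obtain m where m: "n \<le> m" "W m \<omega> \<noteq> x"
        using leave by blast
      have "x < W m \<omega>"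
        using m n incseqD[OF mono m(1)] by simp
      \<comment> \<open>From index \<open>m\<close> on the sequence lies above \<open>x\<close>, so
        the visits form a finite nonempty set, whose maximum is the last visit.\<close>
      then have "j < m" if "W j \<omega> = x" for j
        using that incseqD[OF mono, of m j] by (cases "j < m") auto
      then have "{j. W j \<omega> = x} \<subseteq> {..<m}"
        by blast
      then have fin: "finite {j. W j \<omega> = x}"
        by (rule finite_subset) simp
      let ?j = "Max {j. W j \<omega> = x}"
      have "?j \<in> {j. W j \<omega> = x}"
        using fin n by (intro Max_in) blast+
      moreover have "W i \<omega> \<noteq> x" if "?j < i" for i
        using that Max_ge[OF fin, of i] by auto
      ultimately show ?thesis
        by blast
    qed
    then have "(\<exists>n. W n \<omega> = x \<and> (\<forall>m>n. W m \<omega> \<noteq> x)) \<longleftrightarrow> (\<exists>n. W n \<omega> = x)"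
      by blast
    then show "\<omega> \<in> (\<Union>n. ?C n) \<longleftrightarrow> \<omega> \<in> {\<omega> \<in> space M. \<exists>n. W n \<omega> = x}"
      by simp
  qed measurable
  with sums show ?thesis
    by simp
qed

end

section \<open>The gamma process at integer times\<close>

context gamma_process
begin

lemma expectation_power_mult_exp:
  assumes "0 \<le> t" "0 < u"
  shows "expectation (\<lambda>\<omega>. G t \<omega> ^ k * exp (- u * G t \<omega>)) =
    (\<beta> / (\<beta> + u)) powr (\<alpha> * t) * pochhammer (\<alpha> * t) k / (\<beta> + u) ^ k"
  using assms parameters_pos laplace_transform[of t]
  by (intro expectation_power_mult_exp_gamma random_variable AE_nonneg) auto

lemma integrable_power_mult_exp_process:
  assumes "0 \<le> t" "0 < u"
  shows "integrable M (\<lambda>\<omega>. G t \<omega> ^ k * exp (- u * G t \<omega>))"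
  using assms by (intro integrable_power_mult_exp random_variable AE_nonneg)

text \<open>For every \<open>u > 0\<close> the indicator of \<open>G 1 \<le> 0\<close> is at most
  \<open>exp (- u * G 1)\<close>, and the Laplace transform tends to 0 as \<open>u\<close>
  grows.\<close>

lemma AE_pos_1: "AE \<omega> in M. 0 < G 1 \<omega>"
proof -
  have [measurable]: "G 1 \<in> borel_measurable M"
    by (rule random_variable) simp
  have "((\<lambda>u. (\<beta> / (\<beta> + u)) powr \<alpha>) \<longlongrightarrow> 0) at_top"
  proof -
    have "((\<lambda>u. \<beta> / (\<beta> + u)) \<longlongrightarrow> 0) at_top"
      by (intro tendsto_divide_0[OF tendsto_const] filterlim_at_top_imp_at_infinity
          filterlim_tendsto_add_at_top[OF tendsto_const] filterlim_ident)
    then have "((\<lambda>u. (\<beta> / (\<beta> + u)) powr \<alpha>) \<longlongrightarrow> 0 powr \<alpha>) at_top"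
      using parameters_pos
      by (intro tendsto_powr') (auto intro!: eventually_mono[OF eventually_ge_at_top[of 0]])
    then show ?thesis
      by simp
  qed
  moreover have "\<forall>\<^sub>F u in at_top. \<P>(\<omega> in M. G 1 \<omega> \<le> 0) \<le> (\<beta> / (\<beta> + u)) powr \<alpha>"
    using eventually_gt_at_top[of 0]
  proof eventually_elim
    fix u :: real assume u: "0 < u"
    have "\<P>(\<omega> in M. G 1 \<omega> \<le> 0) = expectation (indicator {\<omega> \<in> space M. G 1 \<omega> \<le> 0})"
      by simp
    also have "\<dots> \<le> expectation (\<lambda>\<omega>. G 1 \<omega> ^ 0 * exp (- u * G 1 \<omega>))"
      using u by (intro integral_mono integrable_power_mult_exp_process)
        (auto split: split_indicator simp: mult_nonneg_nonpos intro!: integrable_real_indicator simp: less_top[symmetric])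
    also have "\<dots> = (\<beta> / (\<beta> + u)) powr \<alpha>"
      using expectation_power_mult_exp[of 1 u 0] u by simp
    finally show "\<P>(\<omega> in M. G 1 \<omega> \<le> 0) \<le> (\<beta> / (\<beta> + u)) powr \<alpha>" .
  qed
  ultimately have "\<P>(\<omega> in M. G 1 \<omega> \<le> 0) \<le> 0"
    by (intro tendsto_lowerbound) auto
  then have "\<P>(\<omega> in M. G 1 \<omega> \<le> 0) = 0"
    by (simp add: measure_le_0_iff)
  then show ?thesis
    by (subst (asm) prob_eq_0) (auto simp: not_le)
qed

lemma distr_unit_increment:
  "distr M borel (\<lambda>\<omega>. G (real (Suc n)) \<omega> - G (real n) \<omega>) = distr M borel (G 1)"
  using stationary_increments[of "real n" 1] by (simp add: add.commute)

text \<open>Each unit increment has the law of \<open>G 1\<close> and is therefore almost surely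
  positive; countably many null sets are discarded.\<close>

lemma AE_strict_mono: "AE \<omega> in M. strict_mono (\<lambda>n. G (real n) \<omega>)"
proof -
  have [measurable]: "G (real n) \<in> borel_measurable M" "G 1 \<in> borel_measurable M" for n
    by (auto intro: random_variable)
  have "AE \<omega> in M. 0 < G (real (Suc n)) \<omega> - G (real n) \<omega>" for n
  proof -
    have "AE x in distr M borel (G 1). 0 < x"
      by (subst AE_distr_iff) (use AE_pos_1 in auto)
    then show ?thesis
      unfolding distr_unit_increment[of n, symmetric] by (subst (asm) AE_distr_iff) (auto simp del: of_nat_Suc)
  qed
  then have "AE \<omega> in M. \<forall>n. 0 < G (real (Suc n)) \<omega> - G (real n) \<omega>"
    by (simp add: AE_all_countable)
  then show ?thesis
    by eventually_elim (simp add: strict_mono_Suc_iff)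
qed

text \<open>The exponential splits into a factor depending on \<open>G n\<close> and one depending
  on the independent unit increment, whose Laplace transform at \<open>u\<close> is the constant in
  front.\<close>

lemma expectation_power_mult_exp_Suc:
  assumes "0 < u"
  shows "expectation (\<lambda>\<omega>. G (real n) \<omega> ^ k * exp (- u * G (real (Suc n)) \<omega>)) =
    (\<beta> / (\<beta> + u)) powr \<alpha> * expectation (\<lambda>\<omega>. G (real n) \<omega> ^ k * exp (- u * G (real n) \<omega>))"
proof -
  have [measurable]: "G (real n) \<in> borel_measurable M" "G 0 \<in> borel_measurable M" "G 1 \<in> borel_measurable M" for n
    by (auto intro: random_variable)
  let ?Z = "\<lambda>\<omega>. G (real (Suc n)) \<omega> - G (real n) \<omega>"
  let ?a = "\<lambda>x. x ^ k * exp (- u * x)" and ?b = "\<lambda>x::real. exp (- u * x)"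
  have a0: "AE \<omega> in M. G (real n) \<omega> - G 0 \<omega> = G (real n) \<omega>"
    using start_zero by eventually_elim simp
  have ind: "indep_var borel (?a \<circ> (\<lambda>\<omega>. G (real n) \<omega> - G 0 \<omega>)) borel (?b \<circ> ?Z)"
    by (intro indep_var_compose[OF indep_var_increment]) auto
  have int_a: "integrable M (\<lambda>\<omega>. ?a (G (real n) \<omega> - G 0 \<omega>))"
  proof (rule integrable_cong_AE_imp)
    show "integrable M (\<lambda>\<omega>. ?a (G (real n) \<omega>))"
      using assms by (intro integrable_power_mult_exp_process) auto
    show "AE \<omega> in M. ?a (G (real n) \<omega>) = ?a (G (real n) \<omega> - G 0 \<omega>)"
      using a0 by eventually_elim simp
  qed measurable
  have "integrable (distr M borel (G 1)) ?b"
    using integrable_power_mult_exp_process[of 1 u 0] assms by (subst integrable_distr_eq) auto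
  then have int_b: "integrable M (\<lambda>\<omega>. ?b (?Z \<omega>))"
    unfolding distr_unit_increment[of n, symmetric] by (subst (asm) integrable_distr_eq) (auto simp del: of_nat_Suc)
  have "expectation (\<lambda>\<omega>. ?b (?Z \<omega>)) = integral\<^sup>L (distr M borel ?Z) ?b"
    by (subst integral_distr) (auto simp del: of_nat_Suc)
  also have "\<dots> = expectation (\<lambda>\<omega>. ?b (G 1 \<omega>))"
    unfolding distr_unit_increment by (subst integral_distr) auto
  also have "\<dots> = (\<beta> / (\<beta> + u)) powr \<alpha>"
    using expectation_power_mult_exp[of 1 u 0] assms by simp
  finally have b: "expectation (\<lambda>\<omega>. ?b (?Z \<omega>)) = (\<beta> / (\<beta> + u)) powr \<alpha>" .
  have "expectation (\<lambda>\<omega>. G (real n) \<omega> ^ k * exp (- u * G (real (Suc n)) \<omega>)) =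
      expectation (\<lambda>\<omega>. ?a (G (real n) \<omega> - G 0 \<omega>) * ?b (?Z \<omega>))"
    by (intro integral_cong_AE, measurable)
       (use a0 in \<open>eventually_elim, simp add: algebra_simps flip: exp_add\<close>)
  also have "\<dots> = expectation (\<lambda>\<omega>. ?a (G (real n) \<omega> - G 0 \<omega>)) * expectation (\<lambda>\<omega>. ?b (?Z \<omega>))"
    using indep_var_lebesgue_integral[OF ind] int_a int_b by (simp add: comp_def)
  also have "expectation (\<lambda>\<omega>. ?a (G (real n) \<omega> - G 0 \<omega>)) = expectation (\<lambda>\<omega>. ?a (G (real n) \<omega>))"
    by (intro integral_cong_AE, measurable) (use a0 in \<open>eventually_elim, simp\<close>)
  finally show ?thesis
    unfolding b by (simp add: mult.commute)
qed

end

text \<open>\<open>B\<close> need not be measurable in \<open>M\<close>, but it differs from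
  \<open>A\<close> only within a null set, which the completion makes measurable.\<close>

lemma measure_completion_eq_AE:
  assumes A: "A \<in> sets M" and B: "B \<subseteq> space M" and ae: "AE x in M. x \<in> A \<longleftrightarrow> x \<in> B"
  shows "measure (completion M) B = measure M A"
proof -
  have ae': "AE x in completion M. x \<in> A \<longleftrightarrow> x \<in> B"
    using ae by (rule AE_completion)
  have A': "A \<in> sets (completion M)"
    using A by simp
  have "B \<in> sets (completion M)"
    by (rule completion.in_sets_AE[OF ae' A']) (use B in simp)
  then have "measure (completion M) A = measure (completion M) B"
    using ae' A' by (intro measure_eq_AE)
  then show ?thesis
    using A by simp
qed

lemma hitting_time_less_infinity_iff: "hitting_time X k \<omega> < \<infinity> \<longleftrightarrow> (\<exists>s\<ge>0. X s \<omega> = k)"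
  unfolding hitting_time_def Inf_less_iff by auto

theorem theorem3:
  fixes M :: "'a measure"
    and l1 l \<alpha> \<beta> :: real
    and N1 N :: "real \<Rightarrow> 'a \<Rightarrow> nat"
    and G G\<^sub>N :: "real \<Rightarrow> 'a \<Rightarrow> real"
    and k :: nat
  assumes "0 < l1" "0 < l" "0 < \<alpha>" "0 < \<beta>"
    and "poisson_process M l1 N1"
    and "poisson_process M l N"
    and "gamma_process M \<alpha> \<beta> G"
    and "prob_space.indep_processes M (\<lambda>t \<omega>. real (N t \<omega>)) G"
    and "G\<^sub>N = subordinated G (\<lambda>t \<omega>. real (N t \<omega>))"
    and "prob_space.indep_processes M (\<lambda>t \<omega>. real (N1 t \<omega>)) G\<^sub>N"
    and "1 \<le> k"
  shows \<comment> \<open>Path properties hold only almost surely, so without completeness of \<open>M\<close> this event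
          is guaranteed to be measurable only in the completion of \<open>M\<close>.\<close>
    "measure (completion M) {\<omega> \<in> space M. hitting_time (subordinated N1 G\<^sub>N) k \<omega> < \<infinity>} =
       l1 ^ k / (fact k * (l1 + \<beta>) ^ k) * (1 - (\<beta> / (l1 + \<beta>)) powr \<alpha>) *
       (\<Sum>n. (\<beta> / (l1 + \<beta>)) powr (\<alpha> * real (Suc n)) *
             Gamma (\<alpha> * real (Suc n) + real k) / Gamma (\<alpha> * real (Suc n)))"
proof -
  interpret N1: poisson_process M l1 N1 by fact
  interpret N: poisson_process M l N by fact
  interpret G: gamma_process M \<alpha> \<beta> G by fact
  define r where "r = (\<beta> / (l1 + \<beta>)) powr \<alpha>"
  \<comment> \<open>Built from the path of \<open>G\<^sub>N\<close> alone, so that its independence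
    of \<open>N1\<close> can be used, although \<open>X n\<close> is meant to be
    \<open>G n\<close>.\<close>
  define X where "X n \<omega> = nth_value (\<lambda>t\<in>{0..}. G\<^sub>N t \<omega>) n" for n \<omega>
  define W where "W n = N1.at_random_time (X n)" for n
  have path [measurable]: "(\<lambda>\<omega>. \<lambda>t\<in>{0..}. G\<^sub>N t \<omega>) \<in> measurable M (\<Pi>\<^sub>M t\<in>{0..}. borel)"
    using assms(10) unfolding N1.indep_processes_def by (rule N1.indep_var_rv2)
  have [measurable]: "X n \<in> borel_measurable M" for n
    unfolding X_def by measurable
  then have [measurable]: "W n \<in> borel_measurable M" for n
    unfolding W_def by measurable
  have [measurable]: "G (real n) \<in> borel_measurable M" for n
    by (auto intro: G.random_variable)

  \<comment> \<open>\<open>N\<close> attains every natural number at a rational time, so the values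
    of \<open>G\<^sub>N\<close> at nonnegative rationals are exactly
    \<open>G 0 < G 1 < \<dots>\<close>, as \<open>nth_value_eq\<close> requires.\<close>
  have XG: "AE \<omega> in M. \<forall>n. X n \<omega> = G (real n) \<omega>"
    using N.AE_attains_all_values G.AE_strict_mono G.start_zero
  proof eventually_elim
    fix \<omega> assume N: "\<forall>n. \<exists>q\<in>\<rat> \<inter> {0..}. N q \<omega> = n" and mono: "strict_mono (\<lambda>n. G (real n) \<omega>)"
      and 0: "G 0 \<omega> = 0"
    have "(\<lambda>t\<in>{0..}. G\<^sub>N t \<omega>) ` (\<rat> \<inter> {0..}) = (\<lambda>n. G (real n) \<omega>) ` ((\<lambda>q. N q \<omega>) ` (\<rat> \<inter> {0..}))"
      unfolding image_image by (intro image_cong) (auto simp: assms(9) subordinated_def)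
    also have "(\<lambda>q. N q \<omega>) ` (\<rat> \<inter> {0..}) = UNIV"
      using N by (auto simp: image_iff set_eq_iff) metis
    finally show "\<forall>n. X n \<omega> = G (real n) \<omega>"
      using mono 0 unfolding X_def by (auto intro!: nth_value_eq)
  qed
  have X_nonneg: "AE \<omega> in M. 0 \<le> X n \<omega>" for n
    using XG G.AE_nonneg[of "real n", simplified] by eventually_elim simp
  have X_le: "AE \<omega> in M. X n \<omega> \<le> X (Suc n) \<omega>" for n
    using XG G.AE_strict_mono
    by eventually_elim (auto dest: strict_mono_leD[where m = n and n = "Suc n"] simp del: of_nat_Suc)
  have WX: "AE \<omega> in M. \<forall>n. W n \<omega> = real (N1 (G (real n) \<omega>) \<omega>)"
  proof -
    have "AE \<omega> in M. \<forall>n. W n \<omega> = real (N1 (X n \<omega>) \<omega>)"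
      unfolding W_def using N1.AE_at_random_time[OF X_nonneg] by (simp add: AE_all_countable)
    then show ?thesis
      using XG by eventually_elim simp
  qed

  \<comment> \<open>Used twice: \<open>m = n\<close> gives the law of a single visit,
    \<open>m = Suc n\<close> the probability of staying at \<open>k\<close> for one more
    step.\<close>
  have joint: "\<P>(\<omega> in M. W n \<omega> = real k \<and> W m \<omega> = real k) =
      l1 ^ k / fact k * N1.expectation (\<lambda>\<omega>. G (real n) \<omega> ^ k * exp (- l1 * G (real m) \<omega>))"
    if "AE \<omega> in M. X n \<omega> \<le> X m \<omega>" for n m
  proof -
    have "\<P>(\<omega> in M. W n \<omega> = real k \<and> W m \<omega> = real k) =
        N1.expectation (\<lambda>\<omega>. (l1 * X n \<omega>) ^ k / fact k * exp (- (l1 * X m \<omega>)))"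
      unfolding W_def using X_nonneg that
      by (intro N1.prob_at_random_times_eq[OF assms(10), of "\<lambda>g. nth_value g n" "\<lambda>g. nth_value g m"])
         (auto simp: X_def fun_eq_iff)
    also have "\<dots> = N1.expectation (\<lambda>\<omega>. l1 ^ k / fact k * (G (real n) \<omega> ^ k * exp (- l1 * G (real m) \<omega>)))"
      by (intro integral_cong_AE, measurable)
         (use XG in \<open>eventually_elim, simp add: power_mult_distrib\<close>)
    finally show ?thesis
      by simp
  qed
  have prob_W: "\<P>(\<omega> in M. W n \<omega> = real k) =
      l1 ^ k / fact k * (\<beta> / (l1 + \<beta>)) powr (\<alpha> * real n) * pochhammer (\<alpha> * real n) k / (l1 + \<beta>) ^ k" for n
    using joint[of n n] G.expectation_power_mult_exp[of "real n" l1 k] \<open>0 < l1\<close> by (simp add: ac_simps)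
  have stay: "\<P>(\<omega> in M. W n \<omega> = real k \<and> W (Suc n) \<omega> = real k) = r * \<P>(\<omega> in M. W n \<omega> = real k)" for n
    using joint[OF X_le, of n] joint[of n n] G.expectation_power_mult_exp_Suc[of l1 n k] \<open>0 < l1\<close>
    by (simp add: r_def add.commute del: of_nat_Suc)
  have "r < 1 powr \<alpha>"
    unfolding r_def using assms(1-4) by (intro powr_less_mono2) auto
  then have "r < 1"
    by simp
  have W_mono: "AE \<omega> in M. incseq (\<lambda>n. W n \<omega>)"
    using WX N1.nondecreasing_paths G.AE_strict_mono G.start_zero
  proof eventually_elim
    fix \<omega> assume W: "\<forall>n. W n \<omega> = real (N1 (G (real n) \<omega>) \<omega>)"
      and N1: "mono_on {0..} (\<lambda>t. real (N1 t \<omega>))" and G: "strict_mono (\<lambda>n. G (real n) \<omega>)" "G 0 \<omega> = 0"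
    have nonneg: "0 \<le> G (real n) \<omega>" for n
      using strict_mono_leD[OF G(1), of 0 n] G(2) by simp
    show "incseq (\<lambda>n. W n \<omega>)"
    proof (rule incseq_SucI)
      fix n
      show "W n \<omega> \<le> W (Suc n) \<omega>"
        using W nonneg[of n] nonneg[of "Suc n"] strict_mono_leD[OF G(1), of n "Suc n"]
          mono_onD[OF N1, of "G (real n) \<omega>" "G (real (Suc n)) \<omega>"] by simp
    qed
  qed
  have hit: "measure (completion M) {\<omega> \<in> space M. hitting_time (subordinated N1 G\<^sub>N) k \<omega> < \<infinity>} =
      \<P>(\<omega> in M. \<exists>n. W n \<omega> = real k)"
  proof (rule measure_completion_eq_AE)
    show "AE \<omega> in M. \<omega> \<in> {\<omega> \<in> space M. \<exists>n. W n \<omega> = real k} \<longleftrightarrow>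
        \<omega> \<in> {\<omega> \<in> space M. hitting_time (subordinated N1 G\<^sub>N) k \<omega> < \<infinity>}"
      using WX N.AE_attains_all_values
    proof eventually_elim
      fix \<omega> assume W: "\<forall>n. W n \<omega> = real (N1 (G (real n) \<omega>) \<omega>)" and N: "\<forall>n. \<exists>q\<in>\<rat> \<inter> {0..}. N q \<omega> = n"
      \<comment> \<open>Every time \<open>s\<close> yields the index \<open>n = N s\<close>, and
        conversely every \<open>n\<close> is attained by \<open>N\<close> at some
        \<open>s \<ge> 0\<close>.\<close>
      have "(\<exists>n. W n \<omega> = real k) \<longleftrightarrow> (\<exists>s\<ge>0. N1 (G (real (N s \<omega>)) \<omega>) \<omega> = k)"
        using W N by (metis IntD2 atLeast_iff of_nat_eq_iff)
      then show "\<omega> \<in> {\<omega> \<in> space M. \<exists>n. W n \<omega> = real k} \<longleftrightarrow>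
          \<omega> \<in> {\<omega> \<in> space M. hitting_time (subordinated N1 G\<^sub>N) k \<omega> < \<infinity>}"
        unfolding hitting_time_less_infinity_iff by (simp add: subordinated_def assms(9))
    qed
  qed auto
  have "(\<lambda>n. (1 - r) * \<P>(\<omega> in M. W n \<omega> = real k)) sums \<P>(\<omega> in M. \<exists>n. W n \<omega> = real k)"
    using W_mono stay \<open>r < 1\<close> by (intro N1.sums_prob_last_visit) auto
  \<comment> \<open>\<open>pochhammer 0 k\<close> vanishes for \<open>k \<ge> 1\<close>. Dropping
    this term makes the series start at \<open>n = 1\<close>, whence \<open>Suc n\<close> in the
    result.\<close>
  moreover have "\<P>(\<omega> in M. W 0 \<omega> = real k) = 0"
    using prob_W[of 0] \<open>1 \<le> k\<close> by (simp add: pochhammer_0_left)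
  ultimately have shift: "(\<lambda>n. (1 - r) * \<P>(\<omega> in M. W (Suc n) \<omega> = real k)) sums \<P>(\<omega> in M. \<exists>n. W n \<omega> = real k)"
    using sums_Suc_iff[of "\<lambda>n. (1 - r) * \<P>(\<omega> in M. W n \<omega> = real k)"] by simp
  define c where "c = l1 ^ k / (fact k * (l1 + \<beta>) ^ k) * (1 - r)"
  define f where "f n = (\<beta> / (l1 + \<beta>)) powr (\<alpha> * real (Suc n)) *
      Gamma (\<alpha> * real (Suc n) + real k) / Gamma (\<alpha> * real (Suc n))" for n
  have "(1 - r) * \<P>(\<omega> in M. W (Suc n) \<omega> = real k) = c * f n" for n
  proof -
    have "0 < \<alpha> * real (Suc n)"
      using \<open>0 < \<alpha>\<close> by simp
    \<comment> \<open>The Gamma quotient requires an argument that is not a nonpositive integer;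
      after the shift it is positive.\<close>
    then have "pochhammer (\<alpha> * real (Suc n)) k = Gamma (\<alpha> * real (Suc n) + real k) / Gamma (\<alpha> * real (Suc n))"
      using nonpos_Ints_nonpos not_less by (intro pochhammer_Gamma) blast
    then show ?thesis
      unfolding prob_W c_def f_def by (simp add: mult_ac del: of_nat_Suc)
  qed
  with shift have sums: "(\<lambda>n. c * f n) sums \<P>(\<omega> in M. \<exists>n. W n \<omega> = real k)"
    by (simp only:)
  \<comment> \<open>A nonzero factor can be cancelled, so summability passes from
    \<open>c * f n\<close> to \<open>f\<close>, and \<open>c\<close> may be pulled out of the
    sum.\<close>
  moreover have "c \<noteq> 0"
    using \<open>r < 1\<close> assms(1-4) by (simp add: c_def)
  ultimately have "summable f"
    by (blast intro: summable_mult_D sums_summable)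
  then have "\<P>(\<omega> in M. \<exists>n. W n \<omega> = real k) = c * (\<Sum>n. f n)"
    using sums_unique[OF sums] suminf_mult[of f c] by simp
  then show ?thesis
    unfolding hit c_def f_def r_def .
qed

end
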